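(* Let $\gamma\in[0,1]$ and take $\Lambda=\Pi_\Upsilon$. Then $B_{\Lambda,\gamma}=C_\gamma$, where $C_\gamma$ is the $\gamma$-relative surprise region for $\tau=\Upsilon(\theta)$; i.e., the optimal region is the $\gamma$-relative surprise region: $B=C_\gamma$ minimizes $$\int_\Theta\int_{\mathcal{T}}P_\theta(\tau\in B(X))\,\Pi_\Upsilon(d\tau)\,\Pi(d\theta)$$ among all regions $B$ satisfying $\Pi_\Upsilon(B(x)\mid x)\ge\Pi_\Upsilon(C_\gamma(x)\mid x)$ for each $x$, and, if $\Pi_\Upsilon(C_\gamma(x)\mid x)=\gamma$ for each $x$, it minimizes this quantity among all $\gamma$-credible regions $B$ for $\Upsilon(\theta)$.
   Context: Setting: $\{f_\theta:\theta\in\Theta\}$ is a statistical model, $f_\theta$ being the density of a probability measure $P_\theta$ with respect to a support measure $\mu$ on the sample space $\mathcal{X}$. $\Pi$ is a proper prior (a probability measure) on $\Theta$ with density $\pi$ with respect to a support measure $\upsilon$. The joint distribution of $(\theta,X)$ is $\theta\sim\Pi$, $X\mid\theta\sim P_\theta$; $\Pi(\cdot\mid x)$ is the posterior of $\theta$ given $X=x$. The parameter of interest is $\tau=\Upsilon(\theta)\in\mathcal{T}$; $\Pi_\Upsilon$ and $\Pi_\Upsilon(\cdot\mid x)$ are its marginal prior and posterior distributions, with densities $\pi_\Upsilon$ and $\pi_\Upsilon(\cdot\mid x)$ with respect to a support measure $\nu_{\mathcal{T}}$ on $\mathcal{T}$. A region is a (measurable) rule $x\mapsto B(x)\subset\mathcal{T}$;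 it is a $\gamma$-credible region for $\Upsilon(\theta)$ if $\Pi_\Upsilon(B(x)\mid x)\ge\gamma$ for every $x\in\mathcal{X}$. For a probability measure $\Lambda$ on $\mathcal{T}$ with density $\lambda$ with respect to $\nu_{\mathcal{T}}$, $$B_{\Lambda,\gamma}(x)=\left\{\tau_0\in\mathcal{T}:\Pi_\Upsilon\left(\left\{\tau:\frac{\pi_\Upsilon(\tau\mid x)}{\lambda(\tau)}>\frac{\pi_\Upsilon(\tau_0\mid x)}{\lambda(\tau_0)}\right\}\,\Big|\,x\right)\le\gamma\right\}.$$ The $\gamma$-relative surprise region is $$C_\gamma(x)=\left\{\tau_0\in\mathcal{T}:\Pi_\Upsilon\left(\left\{\tau:\frac{\pi_\Upsilon(\tau\mid x)}{\pi_\Upsilon(\tau)}>\frac{\pi_\Upsilon(\tau_0\mid x)}{\pi_\Upsilon(\tau_0)}\right\}\,\Big|\,x\right)\le\gamma\right\}.$$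
   Formalization: For γ = 1 minimality is false in general, since C_1(x) is all of 𝒯; there it is stated only under the (necessary) condition that, for prior-predictive almost every x, π_Υ(τ|x) > 0 for Π_Υ-almost every τ. *)

theory Defs
  imports "HOL-Probability.Probability"
begin

definition joint_dist ::
  "'p measure \<Rightarrow> 'x measure \<Rightarrow> ('p \<Rightarrow> 'x measure) \<Rightarrow> ('p \<times> 'x) measure" where
  "joint_dist Prior mu P =
     Prior \<bind> (\<lambda>\<theta>. distr (P \<theta>) (Prior \<Otimes>\<^sub>M mu) (\<lambda>x. (\<theta>, x)))"

definition prior_predictive ::
  "'p measure \<Rightarrow> 'x measure \<Rightarrow> ('p \<Rightarrow> 'x measure) \<Rightarrow> 'x measure" where
  "prior_predictive Prior mu P = distr (joint_dist Prior mu P) mu snd"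

(* The posterior is a version of the regular conditional distribution of the parameter
   given the data; it is a probability measure at every x, including those x at which
   Bayes' formula would read 0/0. *)
definition is_posterior ::
  "'p measure \<Rightarrow> 'x measure \<Rightarrow> ('p \<Rightarrow> 'x measure) \<Rightarrow> ('x \<Rightarrow> 'p measure) \<Rightarrow> bool" where
  "is_posterior Prior mu P post \<longleftrightarrow>
     post \<in> mu \<rightarrow>\<^sub>M prob_algebra Prior \<and>
     (\<forall>A\<in>sets Prior. \<forall>E\<in>sets mu.
        emeasure (joint_dist Prior mu P) (A \<times> E) =
          (\<integral>\<^sup>+x\<in>E. emeasure (post x) A \<partial>prior_predictive Prior mu P))"

(* The support measures mu, ups and nu live on the sample space, the parameter space and
   the range of the parameter of interest Ups.  Densities may take the value infinity. *)
locale bayes_model =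
  fixes mu :: "'x measure" and P :: "'p \<Rightarrow> 'x measure" and f :: "'p \<Rightarrow> 'x \<Rightarrow> ennreal"
    and ups :: "'p measure" and Prior :: "'p measure" and p :: "'p \<Rightarrow> ennreal"
    and nu :: "'t measure" and Ups :: "'p \<Rightarrow> 't"
    and PU :: "'t measure" and pU :: "'t \<Rightarrow> ennreal"
    and post :: "'x \<Rightarrow> 'p measure"
    and postU :: "'x \<Rightarrow> 't measure" and dpostU :: "'x \<Rightarrow> 't \<Rightarrow> ennreal"
  assumes sigma_finite_mu: "sigma_finite_measure mu"
    and sigma_finite_ups: "sigma_finite_measure ups"
    and sigma_finite_nu: "sigma_finite_measure nu"
    and f_measurable: "(\<lambda>(\<theta>, x). f \<theta> x) \<in> borel_measurable (ups \<Otimes>\<^sub>M mu)"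
    and P_density: "\<And>\<theta>. \<theta> \<in> space ups \<Longrightarrow> P \<theta> = density mu (f \<theta>)"
    and P_prob: "\<And>\<theta>. \<theta> \<in> space ups \<Longrightarrow> prob_space (P \<theta>)"
    and p_measurable: "p \<in> borel_measurable ups"
    and Prior_density: "Prior = density ups p"
    and Prior_prob: "prob_space Prior"
    and Ups_measurable: "Ups \<in> ups \<rightarrow>\<^sub>M nu"
    and PU_marginal: "PU = distr Prior nu Ups"
    and pU_measurable: "pU \<in> borel_measurable nu"
    and PU_density: "PU = density nu pU"
    and posterior: "is_posterior Prior mu P post"
    and postU_marginal: "\<And>x. x \<in> space mu \<Longrightarrow> postU x = distr (post x) nu Ups"
    and dpostU_measurable: "(\<lambda>(x, \<tau>). dpostU x \<tau>) \<in> borel_measurable (mu \<Otimes>\<^sub>M nu)"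
    and postU_density: "\<And>x. x \<in> space mu \<Longrightarrow> postU x = density nu (dpostU x)"

definition is_region :: "'x measure \<Rightarrow> 't measure \<Rightarrow> ('x \<Rightarrow> 't set) \<Rightarrow> bool" where
  "is_region mu nu B \<longleftrightarrow> (SIGMA x:space mu. B x) \<in> sets (mu \<Otimes>\<^sub>M nu)"

definition is_credible_region ::
  "'x measure \<Rightarrow> 't measure \<Rightarrow> ('x \<Rightarrow> 't measure) \<Rightarrow> real \<Rightarrow> ('x \<Rightarrow> 't set) \<Rightarrow> bool" where
  "is_credible_region mu nu postU \<gamma> B \<longleftrightarrow>
     is_region mu nu B \<and> (\<forall>x\<in>space mu. measure (postU x) (B x) \<ge> \<gamma>)"

(* Here lam is the density of the measure Lambda with respect to nu.  In ennreal,
   a / 0 is infinity for a > 0, while 0 / 0 = 0 and a / infinity = 0. *)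
definition opt_region ::
  "'t measure \<Rightarrow> ('x \<Rightarrow> 't measure) \<Rightarrow> ('x \<Rightarrow> 't \<Rightarrow> ennreal) \<Rightarrow> ('t \<Rightarrow> ennreal) \<Rightarrow> real
    \<Rightarrow> 'x \<Rightarrow> 't set" where
  "opt_region nu postU dpostU lam \<gamma> x =
     {\<tau>\<^sub>0 \<in> space nu.
        measure (postU x)
          {\<tau> \<in> space nu. dpostU x \<tau> / lam \<tau> > dpostU x \<tau>\<^sub>0 / lam \<tau>\<^sub>0} \<le> \<gamma>}"

definition rel_surprise_region ::
  "'t measure \<Rightarrow> ('x \<Rightarrow> 't measure) \<Rightarrow> ('x \<Rightarrow> 't \<Rightarrow> ennreal) \<Rightarrow> ('t \<Rightarrow> ennreal) \<Rightarrow> real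
    \<Rightarrow> 'x \<Rightarrow> 't set" where
  "rel_surprise_region nu postU dpostU pU \<gamma> x =
     {\<tau>\<^sub>0 \<in> space nu.
        measure (postU x)
          {\<tau> \<in> space nu. dpostU x \<tau> / pU \<tau> > dpostU x \<tau>\<^sub>0 / pU \<tau>\<^sub>0} \<le> \<gamma>}"

definition avg_coverage ::
  "'x measure \<Rightarrow> ('p \<Rightarrow> 'x measure) \<Rightarrow> 'p measure \<Rightarrow> 't measure \<Rightarrow> ('x \<Rightarrow> 't set) \<Rightarrow> ennreal"
  where
  "avg_coverage mu P Prior Lam B =
     (\<integral>\<^sup>+\<theta>. (\<integral>\<^sup>+\<tau>. emeasure (P \<theta>) {x \<in> space mu. \<tau> \<in> B x} \<partial>Lam) \<partial>Prior)"

end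

theory Submission
  imports Defs
begin

text \<open>By Fubini, the average coverage of a region \<open>B\<close> is the integral of \<open>PU (B x)\<close> against
  the prior predictive distribution of \<open>x\<close>, so the claim reduces to a comparison for almost every
  fixed \<open>x\<close>.  There \<open>C x\<close> is upward closed for the ratio of the posterior density to the prior
  density, hence a Neyman--Pearson region: among the sets of at least its posterior mass, it has
  the smallest prior mass.  The threshold is the infimum of the ratio over \<open>C x\<close>.  A zero threshold
  is the delicate case, since \<open>C x\<close> may then contain points of zero posterior density; for
  \<open>\<gamma> < 1\<close> it cannot, and for \<open>\<gamma> = 1\<close> positivity of the posterior density makes
  such points negligible.\<close>

section \<open>Comparing prior and posterior mass at a fixed observation\<close>

lemma neyman_pearson:
  assumes [measurable]: "q \<in> borel_measurable M" "g \<in> borel_measurable M"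
    and [measurable]: "A \<in> sets M" "B \<in> sets M"
    and fin: "finite_measure (density M q)"
    and k: "0 < k" "k < \<infinity>"
    and ge: "AE y in M. y \<in> A \<longrightarrow> k * g y \<le> q y"
    and le: "AE y in M. y \<in> B - A \<longrightarrow> q y \<le> k * g y"
    and mass: "emeasure (density M q) A \<le> emeasure (density M q) B"
  shows "emeasure (density M g) A \<le> emeasure (density M g) B"
proof -
  interpret Q: finite_measure "density M q" by (rule fin)
  have split: "emeasure (density M h) X
      = emeasure (density M h) (X \<inter> Y) + emeasure (density M h) (X - Y)"
    if [measurable]: "X \<in> sets M" "Y \<in> sets M" for X Y and h :: "_ \<Rightarrow> ennreal"
    by (subst plus_emeasure) (auto simp: Int_Diff_Un)
  have "emeasure (density M q) (A \<inter> B) + emeasure (density M q) (A - B)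
      \<le> emeasure (density M q) (A \<inter> B) + emeasure (density M q) (B - A)"
    using mass split[of A B q] split[of B A q] by (simp add: Int_commute)
  \<comment> \<open>The mass of the common part \<open>A \<inter> B\<close> may be cancelled because
    \<open>density M q\<close> is finite. What remains are the two differences, on which
    \<open>q\<close> and \<open>k * g\<close> compare in opposite directions; the positive finite
    factor \<open>k\<close> is divided out at the end.\<close>
  then have q_diff: "emeasure (density M q) (A - B) \<le> emeasure (density M q) (B - A)"
    by (simp add: ennreal_add_left_cancel_le)
  have scale: "k * emeasure (density M g) X = (\<integral>\<^sup>+y. k * g y * indicator X y \<partial>M)"
    if [measurable]: "X \<in> sets M" for X
    by (simp add: emeasure_density nn_integral_cmult mult.assoc)
  have "k * emeasure (density M g) (A - B) \<le> emeasure (density M q) (A - B)"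
    unfolding scale[of "A - B", simplified] using ge
    by (auto simp: emeasure_density intro!: nn_integral_mono_AE split: split_indicator)
  also note q_diff
  also have "emeasure (density M q) (B - A) \<le> k * emeasure (density M g) (B - A)"
    unfolding scale[of "B - A", simplified] using le
    by (auto simp: emeasure_density intro!: nn_integral_mono_AE split: split_indicator)
  finally have "emeasure (density M g) (A - B) \<le> emeasure (density M g) (B - A)"
    using k by (simp add: ennreal_mult_le_mult_iff)
  then show ?thesis
    using split[of A B g] split[of B A g] by (auto simp: Int_commute intro: add_left_mono)
qed

text \<open>The boundary values decide the hypothesis: at \<open>g = \<infinity>\<close> the
  quotient is 0, which a positive \<open>k\<close> excludes, and at \<open>g = 0\<close> the product
  vanishes.\<close>

lemma ennreal_le_divideD:
  fixes k q g :: ennreal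
  assumes "0 < k" "k \<le> q / g"
  shows "k * g \<le> q"
proof (cases "g = 0 \<or> g = \<infinity>")
  case True
  with assms show ?thesis by auto
next
  case False
  then have "q / g * g = q"
    by (simp add: ennreal_divide_times top.not_eq_extremum)
  with assms show ?thesis by (metis mult_right_mono zero_le)
qed

text \<open>Finiteness of \<open>k\<close> excludes a positive \<open>q\<close> over
  \<open>g = 0\<close>, where the quotient is infinite; positivity of \<open>k\<close> makes the
  product infinite at \<open>g = \<infinity>\<close>.\<close>

lemma ennreal_divide_leD:
  fixes k q g :: ennreal
  assumes "0 < k" "k < \<infinity>" "q / g \<le> k"
  shows "q \<le> k * g"
proof (cases "g = 0 \<or> g = \<infinity>")
  case True
  with assms show ?thesis
    by (cases "q = 0") (auto simp: ennreal_mult_top top_unique)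
next
  case False
  then have "q / g * g = q"
    by (simp add: ennreal_divide_times top.not_eq_extremum)
  with assms show ?thesis by (metis mult_right_mono zero_le)
qed

lemma AE_finite_density:
  assumes "g \<in> borel_measurable M" "prob_space (density M g)"
  shows "AE y in M. g y \<noteq> \<infinity>"
proof (rule nn_integral_PInf_AE[OF assms(1)])
  have "(\<integral>\<^sup>+y. g y \<partial>M) = emeasure (density M g) (space M)"
    using assms(1) by (auto simp: emeasure_density intro!: nn_integral_cong)
  then show "(\<integral>\<^sup>+y. g y \<partial>M) \<noteq> \<infinity>"
    using prob_space.emeasure_space_1[OF assms(2)] by simp
qed

text \<open>The role of \<open>nondeg\<close> is visible at \<open>\<gamma> = 1\<close>: there
  \<open>C\<close> is the whole space, and a set \<open>B\<close> omitting the zeros of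
  \<open>q\<close> keeps full posterior mass. It could have smaller prior mass if those zeros were
  not negligible under the prior.\<close>

lemma relative_surprise_optimal:
  fixes M :: "'t measure" and q g :: "'t \<Rightarrow> ennreal" and \<gamma> :: real
  defines "C \<equiv> {y\<^sub>0 \<in> space M.
    measure (density M q) {y \<in> space M. q y / g y > q y\<^sub>0 / g y\<^sub>0} \<le> \<gamma>}"
  assumes q[measurable]: "q \<in> borel_measurable M" and g[measurable]: "g \<in> borel_measurable M"
    and Q: "prob_space (density M q)" and G: "prob_space (density M g)"
    and C_sets[measurable]: "C \<in> sets M" and B_sets[measurable]: "B \<in> sets M"
    and mass: "measure (density M q) C \<le> measure (density M q) B"
    and nondeg: "\<gamma> < 1 \<or> (AE y in density M g. 0 < q y)"
  shows "emeasure (density M g) C \<le> emeasure (density M g) B"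
proof -
  interpret Q: prob_space "density M q" by (rule Q)
  interpret G: prob_space "density M g" by (rule G)
  define r where "r y = q y / g y" for y
  have r_meas[measurable]: "r \<in> borel_measurable M"
    unfolding r_def by measurable
  have C_eq: "C = {y\<^sub>0 \<in> space M. measure (density M q) {y \<in> space M. r y > r y\<^sub>0} \<le> \<gamma>}"
    by (simp add: C_def r_def)
  \<comment> \<open>A larger ratio has a smaller strict superlevel set, hence one of smaller
    posterior mass.\<close>
  have upward: "z \<in> C" if "y \<in> C" "z \<in> space M" "r y \<le> r z" for y z
  proof -
    have "measure (density M q) {w \<in> space M. r w > r z}
        \<le> measure (density M q) {w \<in> space M. r w > r y}"
      using that(3) by (intro Q.finite_measure_mono) auto
    with that show ?thesis by (auto simp: C_eq)
  qed
  \<comment> \<open>The infimum need not be attained: only \<open>r \<ge> k\<close> on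
    \<open>C\<close> and \<open>r \<le> k\<close> off \<open>C\<close> matter. An empty
    \<open>C\<close> gives \<open>k = \<infinity>\<close> and falls under the second case.\<close>
  define k where "k = Inf (r ` C)"
  have k_le: "k \<le> r y" if "y \<in> C" for y
    using that by (simp add: k_def INF_lower)
  have k_ge: "r y \<le> k" if "y \<in> space M" "y \<notin> C" for y
    unfolding k_def using that upward[of _ y] by (intro INF_greatest) (meson linear)
  have mass': "emeasure (density M q) C \<le> emeasure (density M q) B"
    using mass by (simp add: Q.emeasure_eq_measure)
  have g_fin: "AE y in M. g y \<noteq> \<infinity>" and q_fin: "AE y in M. q y \<noteq> \<infinity>"
    using AE_finite_density[OF g G] AE_finite_density[OF q Q] by auto
  consider "k = 0" | "k = \<infinity>" | "0 < k" "k < \<infinity>"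
    by (metis infinity_ennreal_def not_gr_zero top.not_eq_extremum)
  then show ?thesis
  proof cases
    case 1
    \<comment> \<open>Under the posterior \<open>q\<close> is positive almost everywhere, and a
      finite \<open>g\<close> keeps the quotient positive. With \<open>k = 0\<close> all such points
      lie in \<open>C\<close>, so \<open>C\<close>, and therefore \<open>B\<close>, has full
      posterior mass.\<close>
    have pos: "AE y in density M q. 0 < r y"
      using g_fin by (auto simp: AE_density r_def ennreal_zero_less_divide top.not_eq_extremum)
    have "AE y in density M q. y \<in> C"
      using pos AE_space
    proof eventually_elim
      case (elim y)
      with k_ge[of y] 1 show ?case by (auto simp: not_le[symmetric])
    qed
    then have "measure (density M q) C = 1"
      by (simp add: Q.prob_eq_1)
    then have "measure (density M q) B = 1"
      using mass Q.prob_le_1[of B] by linarith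
    then have "AE y in density M q. y \<in> B"
      by (simp add: Q.prob_eq_1)
    \<comment> \<open>A posterior null set can carry prior mass only where \<open>q\<close>
      vanishes, so \<open>B\<close> contains prior-almost all points with \<open>q y > 0\<close>. It
      remains to see that \<open>C\<close> has essentially no others.\<close>
    then have B: "AE y in density M g. 0 < q y \<longrightarrow> y \<in> B"
      by (auto simp: AE_density)
    have "AE y in density M g. y \<in> C \<longrightarrow> 0 < q y"
    proof (cases "\<gamma> < 1")
      case True
      have "measure (density M q) {y \<in> space M. r y > 0} = 1"
        using pos by (subst Q.prob_eq_1) (auto elim: eventually_mono)
      \<comment> \<open>If \<open>r y = 0\<close>, the points of larger ratio have posterior mass 1,
        which exceeds \<gamma>, so \<open>y\<close> fails the defining condition of
        \<open>C\<close>.\<close>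
      with True have "0 < r y" if "y \<in> C" for y
        using that by (cases "r y = 0") (auto simp: C_eq zero_less_iff_neq_zero)
      then have "0 < q y" if "y \<in> C" for y
        using that by (fastforce simp: r_def ennreal_zero_less_divide)
      then show ?thesis by simp
    next
      case False
      with nondeg show ?thesis by auto
    qed
    with B show ?thesis
      by (intro emeasure_mono_AE) (auto elim: eventually_elim2)
  next
    case 2
    \<comment> \<open>On \<open>C\<close> the ratio is infinite; where \<open>q\<close> is finite
      this forces \<open>g y = 0\<close>. Thus \<open>C\<close> is null under the prior.\<close>
    have "AE y in M. y \<in> C \<longrightarrow> g y = 0"
      using q_fin
    proof eventually_elim
      case (elim y)
      show ?case
      proof
        assume "y \<in> C"
        with k_le 2 have "r y = \<infinity>" by (auto simp: top_unique)
        with elim show "g y = 0"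
          by (auto simp: r_def ennreal_divide_eq_top_iff)
      qed
    qed
    then have "AE y in density M g. y \<notin> C"
      by (auto simp: AE_density elim!: eventually_mono)
    then have "emeasure (density M g) C = 0"
      by (subst (asm) AE_iff_measurable[of C]) (auto dest: sets.sets_into_space[OF C_sets, THEN subsetD])
    then show ?thesis by simp
  next
    case 3
    show ?thesis
    proof (rule neyman_pearson[OF q g C_sets B_sets _ 3 _ _ mass'])
      show "finite_measure (density M q)" by (rule Q.finite_measure_axioms)
      show "AE y in M. y \<in> C \<longrightarrow> k * g y \<le> q y"
        using k_le 3 by (auto simp: r_def intro!: ennreal_le_divideD)
      show "AE y in M. y \<in> B - C \<longrightarrow> q y \<le> k * g y"
        using k_ge 3 sets.sets_into_space[OF B_sets]
        by (auto simp: r_def intro!: ennreal_divide_leD)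
    qed
  qed
qed

section \<open>Measurability of kernels and regions, and exchange of integrals\<close>

lemma is_region_sets:
  assumes "is_region mu nu B" "x \<in> space mu"
  shows "B x \<in> sets nu"
proof -
  have "Pair x -` (SIGMA x:space mu. B x) \<in> sets nu"
    using assms(1) unfolding is_region_def by (rule sets_Pair1)
  moreover have "Pair x -` (SIGMA x:space mu. B x) = B x"
    using assms(2) by auto
  ultimately show ?thesis by simp
qed

context bayes_model
begin

lemma sets_Prior [measurable_cong]: "sets Prior = sets ups"
  by (simp add: Prior_density)

lemma space_Prior: "space Prior = space ups"
  by (rule sets_eq_imp_space_eq) (rule sets_Prior)

lemma prob_space_PU: "prob_space PU"
  unfolding PU_marginal using Ups_measurable
  by (intro prob_space.prob_space_distr Prior_prob) (simp add: Prior_density)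

lemma prob_space_postU:
  assumes "x \<in> space mu"
  shows "prob_space (postU x)"
proof -
  have "post x \<in> space (prob_algebra Prior)"
    using posterior assms by (auto simp: is_posterior_def dest: measurable_space)
  then have *: "prob_space (post x)" "sets (post x) = sets ups"
    by (auto simp: space_prob_algebra sets_Prior)
  then have "Ups \<in> post x \<rightarrow>\<^sub>M nu"
    using Ups_measurable by (simp cong: measurable_cong_sets)
  with * show ?thesis
    by (simp add: postU_marginal assms prob_space.prob_space_distr)
qed

text \<open>Each probability is an integral of the jointly measurable \<open>f\<close> against the
  sigma-finite \<open>mu\<close>, hence measurable in the parameter. This makes the
  \<open>bind\<close> in \<open>joint_dist\<close> tractable.\<close>

lemma kernel_measurable: "P \<in> Prior \<rightarrow>\<^sub>M subprob_algebra mu"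
proof (rule measurable_subprob_algebra)
  fix \<theta> assume "\<theta> \<in> space Prior"
  then have \<theta>: "\<theta> \<in> space ups" by (simp add: space_Prior)
  show "subprob_space (P \<theta>)"
    using P_prob[OF \<theta>] by (rule prob_space_imp_subprob_space)
  show "sets (P \<theta>) = sets mu"
    by (simp add: P_density[OF \<theta>])
next
  interpret sigma_finite_measure mu by (rule sigma_finite_mu)
  note f_measurable[measurable]
  fix A assume [measurable]: "A \<in> sets mu"
  have "(\<lambda>\<theta>. \<integral>\<^sup>+x. f \<theta> x * indicator A x \<partial>mu) \<in> borel_measurable ups"
    by measurable
  also have "?this \<longleftrightarrow> (\<lambda>\<theta>. emeasure (P \<theta>) A) \<in> borel_measurable ups"
  proof (rule measurable_cong)
    fix \<theta> assume \<theta>[measurable]: "\<theta> \<in> space ups"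
    have "f \<theta> \<in> borel_measurable mu" by measurable
    then show "(\<integral>\<^sup>+x. f \<theta> x * indicator A x \<partial>mu) = emeasure (P \<theta>) A"
      by (simp add: P_density[OF \<theta>] emeasure_density)
  qed
  finally show "(\<lambda>\<theta>. emeasure (P \<theta>) A) \<in> borel_measurable Prior"
    by (simp cong: measurable_cong_sets add: sets_Prior)
qed

lemma joint_kernel_measurable:
  "(\<lambda>\<theta>. distr (P \<theta>) (Prior \<Otimes>\<^sub>M mu) (\<lambda>x. (\<theta>, x))) \<in> Prior \<rightarrow>\<^sub>M subprob_algebra (Prior \<Otimes>\<^sub>M mu)"
  using kernel_measurable by (intro measurable_distr2[where M = mu]) auto

text \<open>The data coordinate of the joint distribution is a mixture of the sampling
  distributions: integrating through the push-forward and the \<open>bind\<close> exposes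
  it.\<close>

lemma nn_integral_prior_predictive:
  assumes [measurable]: "h \<in> borel_measurable mu"
  shows "(\<integral>\<^sup>+x. h x \<partial>prior_predictive Prior mu P) = (\<integral>\<^sup>+\<theta>. (\<integral>\<^sup>+x. h x \<partial>P \<theta>) \<partial>Prior)"
proof -
  interpret Prior: prob_space Prior by (rule Prior_prob)
  note [measurable] = joint_kernel_measurable
  have sets_joint: "sets (joint_dist Prior mu P) = sets (Prior \<Otimes>\<^sub>M mu)"
    unfolding joint_dist_def
    by (rule sets_bind) (auto simp: Prior.not_empty)
  have snd: "snd \<in> joint_dist Prior mu P \<rightarrow>\<^sub>M mu"
    by (simp add: measurable_cong_sets[OF sets_joint refl])
  have "(\<integral>\<^sup>+x. h x \<partial>prior_predictive Prior mu P)
      = (\<integral>\<^sup>+z. h (snd z) \<partial>joint_dist Prior mu P)"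
    unfolding prior_predictive_def using snd by (simp add: nn_integral_distr)
  also have "\<dots> = (\<integral>\<^sup>+\<theta>. (\<integral>\<^sup>+z. h (snd z)
      \<partial>distr (P \<theta>) (Prior \<Otimes>\<^sub>M mu) (\<lambda>x. (\<theta>, x))) \<partial>Prior)"
    unfolding joint_dist_def
    by (rule nn_integral_bind[OF _ joint_kernel_measurable]) measurable
  also have "\<dots> = (\<integral>\<^sup>+\<theta>. (\<integral>\<^sup>+x. h x \<partial>P \<theta>) \<partial>Prior)"
  proof (rule nn_integral_cong)
    fix \<theta> assume \<theta>: "\<theta> \<in> space Prior"
    then have [measurable_cong]: "sets (P \<theta>) = sets mu"
      by (simp add: P_density space_Prior)
    have "(\<lambda>x. (\<theta>, x)) \<in> P \<theta> \<rightarrow>\<^sub>M Prior \<Otimes>\<^sub>M mu"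
      using \<theta> by measurable
    then show "(\<integral>\<^sup>+z. h (snd z) \<partial>distr (P \<theta>) (Prior \<Otimes>\<^sub>M mu) (\<lambda>x. (\<theta>, x)))
        = (\<integral>\<^sup>+x. h x \<partial>P \<theta>)"
      by (simp add: nn_integral_distr)
  qed
  finally show ?thesis .
qed

lemma region_mass_measurable:
  assumes "is_region mu nu B"
  shows "(\<lambda>x. emeasure PU (B x)) \<in> borel_measurable mu"
proof -
  interpret PU: prob_space PU by (rule prob_space_PU)
  have [measurable_cong]: "sets PU = sets nu" by (simp add: PU_density)
  have "(SIGMA x:space mu. B x) \<in> sets (mu \<Otimes>\<^sub>M PU)"
    using assms unfolding is_region_def
    by (simp add: sets_pair_measure_cong[OF refl \<open>sets PU = sets nu\<close>])
  then have "(\<lambda>x. emeasure PU (Pair x -` (SIGMA x:space mu. B x))) \<in> borel_measurable mu"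
    by (rule PU.measurable_emeasure_Pair)
  also have "?this \<longleftrightarrow> ?thesis"
    by (intro measurable_cong arg_cong[where f = "emeasure PU"]) auto
  finally show ?thesis .
qed

text \<open>For a fixed parameter, both inner integrals are the mass of the graph of
  \<open>B\<close> under \<open>P \<theta> \<Otimes>\<^sub>M PU\<close>, sliced along one coordinate
  or the other. After slicing at \<open>x\<close>, the integrand no longer involves the parameter,
  so the outer mixture is the prior predictive.\<close>

lemma avg_coverage_eq:
  assumes B: "is_region mu nu B"
  shows "avg_coverage mu P Prior PU B
    = (\<integral>\<^sup>+x. emeasure PU (B x) \<partial>prior_predictive Prior mu P)"
  unfolding avg_coverage_def nn_integral_prior_predictive[OF region_mass_measurable[OF B]]
proof (rule nn_integral_cong)
  fix \<theta> assume "\<theta> \<in> space Prior"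
  then have \<theta>: "\<theta> \<in> space ups" by (simp add: space_Prior)
  define S where "S = (SIGMA x:space mu. B x)"
  interpret PU: prob_space PU by (rule prob_space_PU)
  interpret P: prob_space "P \<theta>" by (rule P_prob[OF \<theta>])
  interpret pair_sigma_finite "P \<theta>" PU ..
  have sets_PU: "sets PU = sets nu" by (simp add: PU_density)
  have sets_P: "sets (P \<theta>) = sets mu" by (simp add: P_density[OF \<theta>])
  have space_P: "space (P \<theta>) = space mu"
    by (rule sets_eq_imp_space_eq) (rule sets_P)
  have S[measurable]: "S \<in> sets (P \<theta> \<Otimes>\<^sub>M PU)"
    using B unfolding is_region_def S_def
    by (simp add: sets_pair_measure_cong[OF sets_P sets_PU])
  have "(\<integral>\<^sup>+\<tau>. emeasure (P \<theta>) {x \<in> space mu. \<tau> \<in> B x} \<partial>PU)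
      = (\<integral>\<^sup>+\<tau>. emeasure (P \<theta>) ((\<lambda>x. (x, \<tau>)) -` S) \<partial>PU)"
    by (intro nn_integral_cong arg_cong[where f = "emeasure (P \<theta>)"]) (auto simp: S_def)
  also have "\<dots> = emeasure (P \<theta> \<Otimes>\<^sub>M PU) S"
    by (rule emeasure_pair_measure_alt2[OF S, symmetric])
  also have "\<dots> = (\<integral>\<^sup>+x. emeasure PU (Pair x -` S) \<partial>P \<theta>)"
    by (rule PU.emeasure_pair_measure_alt[OF S])
  also have "\<dots> = (\<integral>\<^sup>+x. emeasure PU (B x) \<partial>P \<theta>)"
    by (intro nn_integral_cong arg_cong[where f = "emeasure PU"]) (auto simp: S_def space_P)
  finally show "(\<integral>\<^sup>+\<tau>. emeasure (P \<theta>) {x \<in> space mu. \<tau> \<in> B x} \<partial>PU)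
      = (\<integral>\<^sup>+x. emeasure PU (B x) \<partial>P \<theta>)" .
qed

lemma is_region_rel_surprise:
  "is_region mu nu (rel_surprise_region nu postU dpostU pU \<gamma>)"
proof -
  interpret nu: sigma_finite_measure nu by (rule sigma_finite_nu)
  note [measurable] = dpostU_measurable pU_measurable
  \<comment> \<open>Writing the posterior mass as an integral against the fixed measure
    \<open>nu\<close> gives joint measurability in \<open>x\<close> and
    \<open>\<tau>\<^sub>0\<close>, since both enter only through a jointly measurable
    integrand.\<close>
  define m where "m z = (\<integral>\<^sup>+\<tau>. dpostU (fst z) \<tau>
      * indicator {\<tau> \<in> space nu. dpostU (fst z) \<tau> / pU \<tau> > dpostU (fst z) (snd z) / pU (snd z)} \<tau>
      \<partial>nu)" for z
  have [measurable]: "m \<in> borel_measurable (mu \<Otimes>\<^sub>M nu)"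
    unfolding m_def by measurable
  have m_eq: "m (x, \<tau>\<^sub>0) = ennreal (measure (postU x)
      {\<tau> \<in> space nu. dpostU x \<tau> / pU \<tau> > dpostU x \<tau>\<^sub>0 / pU \<tau>\<^sub>0})"
    if [measurable]: "x \<in> space mu" "\<tau>\<^sub>0 \<in> space nu" for x \<tau>\<^sub>0
  proof -
    interpret postU: prob_space "postU x" by (rule prob_space_postU[OF that(1)])
    have "dpostU x \<in> borel_measurable nu" by measurable
    then show ?thesis
      unfolding postU.emeasure_eq_measure[symmetric]
      by (simp add: m_def postU_density[OF that(1)] emeasure_density)
  qed
  \<comment> \<open>By \<open>m_eq\<close> the values of \<open>m\<close> on the product space are
    finite, so \<open>enn2real\<close> loses no information.\<close>
  have "(SIGMA x:space mu. rel_surprise_region nu postU dpostU pU \<gamma> x)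
      = {z \<in> space (mu \<Otimes>\<^sub>M nu). enn2real (m z) \<le> \<gamma>}"
    by (auto simp: rel_surprise_region_def space_pair_measure m_eq)
  then show ?thesis
    unfolding is_region_def by simp
qed

lemma rel_surprise_region_optimal:
  fixes \<gamma> :: real
  defines "C \<equiv> rel_surprise_region nu postU dpostU pU \<gamma>"
  assumes nondeg: "\<gamma> < 1 \<or> (AE x in prior_predictive Prior mu P. AE \<tau> in PU. dpostU x \<tau> > 0)"
    and B: "is_region mu nu B"
    and mass: "\<And>x. x \<in> space mu \<Longrightarrow> measure (postU x) (C x) \<le> measure (postU x) (B x)"
  shows "avg_coverage mu P Prior PU C \<le> avg_coverage mu P Prior PU B"
proof -
  have C: "is_region mu nu C"
    unfolding C_def by (rule is_region_rel_surprise)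
  have optimal: "emeasure PU (C x) \<le> emeasure PU (B x)"
    if x: "x \<in> space mu" and nd: "\<gamma> < 1 \<or> (AE \<tau> in PU. dpostU x \<tau> > 0)" for x
  proof -
    have q: "dpostU x \<in> borel_measurable nu"
      using measurable_Pair2[OF dpostU_measurable x] by simp
    have Cx: "C x = {\<tau>\<^sub>0 \<in> space nu. measure (density nu (dpostU x))
        {\<tau> \<in> space nu. dpostU x \<tau> / pU \<tau> > dpostU x \<tau>\<^sub>0 / pU \<tau>\<^sub>0} \<le> \<gamma>}"
      by (simp add: C_def rel_surprise_region_def postU_density[OF x])
    show ?thesis
      using relative_surprise_optimal[OF q pU_measurable, of \<gamma> "B x", folded Cx]
        prob_space_postU[OF x] prob_space_PU is_region_sets[OF C x] is_region_sets[OF B x]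
        mass[OF x] nd[unfolded PU_density]
      by (simp add: postU_density[OF x] PU_density)
  qed
  \<comment> \<open>The pointwise comparison is available only on \<open>space mu\<close>; as a
    push-forward to \<open>mu\<close>, the predictive distribution has exactly this space.\<close>
  have "AE x in prior_predictive Prior mu P. x \<in> space mu"
    using AE_space[of "prior_predictive Prior mu P"] by (simp add: prior_predictive_def)
  moreover have "AE x in prior_predictive Prior mu P. \<gamma> < 1 \<or> (AE \<tau> in PU. dpostU x \<tau> > 0)"
    using nondeg by (cases "\<gamma> < 1") auto
  ultimately have "AE x in prior_predictive Prior mu P. emeasure PU (C x) \<le> emeasure PU (B x)"
    by eventually_elim (rule optimal)
  then show ?thesis
    unfolding avg_coverage_eq[OF B] avg_coverage_eq[OF C] by (rule nn_integral_mono_AE)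
qed

end

theorem corollary4:
  fixes mu :: "'x measure" and P :: "'p \<Rightarrow> 'x measure" and f :: "'p \<Rightarrow> 'x \<Rightarrow> ennreal"
    and ups :: "'p measure" and Prior :: "'p measure" and p :: "'p \<Rightarrow> ennreal"
    and nu :: "'t measure" and Ups :: "'p \<Rightarrow> 't"
    and PU :: "'t measure" and pU :: "'t \<Rightarrow> ennreal"
    and post :: "'x \<Rightarrow> 'p measure"
    and postU :: "'x \<Rightarrow> 't measure" and dpostU :: "'x \<Rightarrow> 't \<Rightarrow> ennreal"
    and \<gamma> :: real and C :: "'x \<Rightarrow> 't set"
  assumes model: "bayes_model mu P f ups Prior p nu Ups PU pU post postU dpostU"
    and gamma: "0 \<le> \<gamma>" "\<gamma> \<le> 1"
    and C: "C = rel_surprise_region nu postU dpostU pU \<gamma>"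
  shows "opt_region nu postU dpostU pU \<gamma> = C \<and>
    (\<gamma> < 1 \<or> (AE x in prior_predictive Prior mu P. AE \<tau> in PU. dpostU x \<tau> > 0) \<longrightarrow>
      is_arg_min (avg_coverage mu P Prior PU)
        (\<lambda>B. is_region mu nu B \<and>
             (\<forall>x\<in>space mu. measure (postU x) (B x) \<ge> measure (postU x) (C x))) C \<and>
      ((\<forall>x\<in>space mu. measure (postU x) (C x) = \<gamma>) \<longrightarrow>
        is_arg_min (avg_coverage mu P Prior PU) (is_credible_region mu nu postU \<gamma>) C))"
proof -
  interpret bayes_model mu P f ups Prior p nu Ups PU pU post postU dpostU
    by (rule model)
  have region: "is_region mu nu C"
    unfolding C by (rule is_region_rel_surprise)
  \<comment> \<open>Both minimality claims follow from one fact about an arbitrary constraint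
    \<open>Q\<close>: \<open>C\<close> satisfies it, and it forces at least the posterior mass of
    \<open>C\<close>. When that mass equals \<gamma> everywhere, credibility is such a
    constraint.\<close>
  have optimal: "is_arg_min (avg_coverage mu P Prior PU) Q C"
    if "\<gamma> < 1 \<or> (AE x in prior_predictive Prior mu P. AE \<tau> in PU. dpostU x \<tau> > 0)"
      and "Q C" and "\<And>B. Q B \<Longrightarrow> is_region mu nu B \<and>
        (\<forall>x\<in>space mu. measure (postU x) (B x) \<ge> measure (postU x) (C x))" for Q
    unfolding is_arg_min_def not_ex de_Morgan_conj not_less
    using that rel_surprise_region_optimal[of \<gamma>, folded C] by blast
  have "opt_region nu postU dpostU pU \<gamma> = C"
    by (simp add: C fun_eq_iff opt_region_def rel_surprise_region_def)
  then show ?thesis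
    using region by (intro conjI impI optimal) (auto simp: is_credible_region_def)
qed

end
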